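(* Let $(T,c)$ be an algebraic tree with component topology $\tau$. Then the following are equivalent: 1. There exists a countable set $D\subseteq T$ such that $D\cap[x,y)\neq\emptyset$ for all $x,y\in T$ with $x\neq y$. 2. The topological space $(T,\tau)$ is second countable, and $\mathrm{edge}(T,c)$ is countable. 3. The topological space $(T,\tau)$ is separable, and $\mathrm{edge}(T,c)$ is countable.
   Context: An algebraic tree $(T,c)$ is a set $T\neq\emptyset$ with a map $c\colon T^3\to T$ such that for all points: $c$ is symmetric; $c(x,y,y)=y$; $c(x,y,c(x,y,z))=c(x,y,z)$; and $c(x_1,x_2,x_3)\in\{c(x_1,x_2,x_4),c(x_1,x_3,x_4),c(x_2,x_3,x_4)\}$. Intervals: $[x,y]:=\{z\in T: c(x,y,z)=z\}$, $[x,y):=[x,y]\setminus\{y\}$. The set of edges is $\mathrm{edge}(T,c):=\{\{x,y\}\subseteq T: x\ne y,\ [x,y]=\{x,y\}\}$. For $x\neq y$ the component of $T\setminus\{x\}$ containing $y$ is $\mathcal{S}_x(y):=\{z\in T\setminus\{x\}: c(x,y,z)\ne x\}$. The component topology $\tau$ is the coarsest topology on $T$ in which all $\mathcal{S}_x(y)$, $x\ne y$, are open. "Countable" includes finite. *)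

theory Defs
  imports "HOL-Analysis.Abstract_Topological_Spaces" "HOL-Analysis.Function_Topology"
begin

text \<open>The two symmetry axioms are transpositions generating all permutations of the arguments.
  The axioms constrain \<open>c\<close> on the carrier \<open>T\<close> only; its values elsewhere are irrelevant.\<close>

locale algebraic_tree =
  fixes T :: "'a set" and c :: "'a \<Rightarrow> 'a \<Rightarrow> 'a \<Rightarrow> 'a"
  assumes nonempty: "T \<noteq> {}"
    and closed: "\<lbrakk>x \<in> T; y \<in> T; z \<in> T\<rbrakk> \<Longrightarrow> c x y z \<in> T"
    and sym12: "\<lbrakk>x \<in> T; y \<in> T; z \<in> T\<rbrakk> \<Longrightarrow> c x y z = c y x z"
    and sym23: "\<lbrakk>x \<in> T; y \<in> T; z \<in> T\<rbrakk> \<Longrightarrow> c x y z = c x z y"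
    and two_point: "\<lbrakk>x \<in> T; y \<in> T\<rbrakk> \<Longrightarrow> c x y y = y"
    and three_point: "\<lbrakk>x \<in> T; y \<in> T; z \<in> T\<rbrakk> \<Longrightarrow> c x y (c x y z) = c x y z"
    and four_point: "\<lbrakk>x1 \<in> T; x2 \<in> T; x3 \<in> T; x4 \<in> T\<rbrakk>
          \<Longrightarrow> c x1 x2 x3 \<in> {c x1 x2 x4, c x1 x3 x4, c x2 x3 x4}"

definition tree_interval :: "'a set \<Rightarrow> ('a \<Rightarrow> 'a \<Rightarrow> 'a \<Rightarrow> 'a) \<Rightarrow> 'a \<Rightarrow> 'a \<Rightarrow> 'a set"
  where "tree_interval T c x y = {z \<in> T. c x y z = z}"

definition tree_interval_ropen :: "'a set \<Rightarrow> ('a \<Rightarrow> 'a \<Rightarrow> 'a \<Rightarrow> 'a) \<Rightarrow> 'a \<Rightarrow> 'a \<Rightarrow> 'a set"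
  where "tree_interval_ropen T c x y = tree_interval T c x y - {y}"

definition tree_edges :: "'a set \<Rightarrow> ('a \<Rightarrow> 'a \<Rightarrow> 'a \<Rightarrow> 'a) \<Rightarrow> 'a set set"
  where "tree_edges T c =
    {{x, y} | x y. x \<in> T \<and> y \<in> T \<and> x \<noteq> y \<and> tree_interval T c x y = {x, y}}"

definition tree_component :: "'a set \<Rightarrow> ('a \<Rightarrow> 'a \<Rightarrow> 'a \<Rightarrow> 'a) \<Rightarrow> 'a \<Rightarrow> 'a \<Rightarrow> 'a set"
  where "tree_component T c x y = {z \<in> T - {x}. c x y z \<noteq> x}"

text \<open>The carrier of \<^const>\<open>topology_generated_by\<close> is the union of the generating family.
  Inserting \<open>T\<close> into the family ensures that this union is \<open>T\<close> even when \<open>T\<close> is a singleton,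
  in which case there are no components.\<close>

definition component_topology :: "'a set \<Rightarrow> ('a \<Rightarrow> 'a \<Rightarrow> 'a \<Rightarrow> 'a) \<Rightarrow> 'a topology"
  where "component_topology T c = topology_generated_by
    (insert T {tree_component T c x y | x y. x \<in> T \<and> y \<in> T \<and> x \<noteq> y})"

lemma topspace_component_topology [simp]: "topspace (component_topology T c) = T"
  by (auto simp: component_topology_def topology_generated_by_topspace tree_component_def)

end

theory Submission
  imports Defs
begin

text \<open>If \<open>D\<close> meets all half-open intervals, then for \<open>z \<in> \<S>\<^sub>x(y)\<close> a point \<open>d\<close> of \<open>D\<close> in \<open>[x,z)\<close> and
  a point \<open>e\<close> of \<open>D\<close> in \<open>(d,z]\<close> give \<open>z \<in> \<S>\<^sub>d(e) \<subseteq> \<S>\<^sub>x(y)\<close>, so countably many components form a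
  subbase; moreover both endpoints of an edge lie in \<open>D\<close>. Conversely, if \<open>E\<close> is dense, then \<open>[x,y)\<close>
  contains an endpoint of an edge or a branch point \<open>c(a,b,e)\<close> with \<open>a, b, e \<in> E\<close>: if \<open>{x,y}\<close> is not
  an edge, density yields \<open>e\<close> with \<open>p = c(x,y,e)\<close> strictly between \<open>x\<close> and \<open>y\<close>, and \<open>x\<close>, \<open>y\<close> can be
  replaced by points of \<open>E\<close> in the components of \<open>T - {p}\<close> containing them.\<close>

text \<open>Finite intersections of members of \<open>\<C>\<close> form a countable base: induction
  on how an open set arises from \<open>\<S>\<close> fits one around each of its points.\<close>

lemma second_countable_topology_generated_by:
  assumes "countable \<C>"
    and op: "\<And>C. C \<in> \<C> \<Longrightarrow> openin (topology_generated_by \<S>) C"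
    and sub: "\<And>S z. S \<in> \<S> \<Longrightarrow> z \<in> S \<Longrightarrow> \<exists>C\<in>\<C>. z \<in> C \<and> C \<subseteq> S"
  shows "second_countable (topology_generated_by \<S>)"
proof -
  \<comment> \<open>\<open>F \<noteq> {}\<close> excludes \<open>\<Inter>{} = UNIV\<close>, which
    need not be open.\<close>
  let ?B = "Inter ` {F. (finite F \<and> F \<subseteq> \<C>) \<and> F \<noteq> {}}"
  have "countable {F. (finite F \<and> F \<subseteq> \<C>) \<and> F \<noteq> {}}"
    using countable_Collect_finite_subset[OF assms(1)] by (rule countable_subset[rotated]) auto
  moreover have "openin (topology_generated_by \<S>) V" if "V \<in> ?B" for V
    using that op by (auto intro!: openin_Inter)
  moreover have "\<exists>V\<in>?B. z \<in> V \<and> V \<subseteq> U"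
    if "openin (topology_generated_by \<S>) U" "z \<in> U" for U z
    using openin_topology_generated_by[OF that(1)] that(2)
  proof induction
    case (Int U V)
    then obtain F G where "finite F" "F \<subseteq> \<C>" "F \<noteq> {}" "z \<in> \<Inter>F" "\<Inter>F \<subseteq> U"
      and "finite G" "G \<subseteq> \<C>" "z \<in> \<Inter>G" "\<Inter>G \<subseteq> V"
      by auto
    then show ?case
      by (intro bexI[of _ "\<Inter>(F \<union> G)"] imageI) auto
  next
    case (UN K)
    then show ?case by (meson Union_iff Union_upper order_trans)
  next
    case (Basis S)
    then obtain C where "C \<in> \<C>" "z \<in> C" "C \<subseteq> S" using sub by blast
    then show ?case
      by (intro bexI[of _ "\<Inter>{C}"] imageI) auto
  qed simp
  ultimately show ?thesis
    unfolding second_countable_def by (intro exI[of _ ?B] conjI countable_image) auto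
qed

context algebraic_tree
begin

lemma c_idem_left: "\<lbrakk>x \<in> T; y \<in> T\<rbrakk> \<Longrightarrow> c x y x = x"
  by (metis sym12 sym23 two_point)

text \<open>If \<open>x\<close> separated \<open>y\<close> from \<open>w\<close>, the four-point
  axiom with fourth point \<open>z\<close> would leave only \<open>c y w z = x\<close>, so
  \<open>x\<close> would lie on \<open>[y,z]\<close>, against \<open>yz\<close>.\<close>

lemma component_trans:
  assumes T: "x \<in> T" "y \<in> T" "z \<in> T" "w \<in> T"
    and yz: "c x y z \<noteq> x" and zw: "c x z w \<noteq> x"
  shows "c x y w \<noteq> x"
proof
  assume "c x y w = x"
  then have "c y w z = x"
    using four_point[of x y w z] T yz zw by (auto simp: sym23)
  then have "c y z x = x"
    by (metis T sym23 three_point)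
  then show False by (metis T sym12 sym23 yz)
qed

lemma component_cong:
  assumes T: "x \<in> T" "y \<in> T" "z \<in> T" and "c x y z \<noteq> x"
  shows "tree_component T c x y = tree_component T c x z"
proof -
  have "c x z y \<noteq> x" using assms by (metis sym23)
  then show ?thesis
    using component_trans[of x y z] component_trans[of x z y] assms
    by (auto simp: tree_component_def)
qed

lemma interval_subset:
  assumes T: "w \<in> T" "z \<in> T" and x: "x \<in> tree_interval T c w z"
  shows "tree_interval T c x z \<subseteq> tree_interval T c w z"
proof
  fix d assume "d \<in> tree_interval T c x z"
  then have d: "d \<in> T" "c x z d = d" and x: "x \<in> T" "c w z x = x"
    using x by (auto simp: tree_interval_def)
  have "c w z d = d"
  proof (cases "d = x")
    case False
    \<comment> \<open>Otherwise \<open>x\<close> lies on \<open>[d,z]\<close> and \<open>d\<close>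
      on \<open>[x,z]\<close>, forcing \<open>d = x\<close>.\<close>
    have "c w z d \<noteq> x"
    proof
      assume "c w z d = x"
      then have "c z d x = x" by (metis T d(1) x(1) sym12 sym23 three_point)
      then show False using d x T False by (metis sym12 sym23)
    qed
    \<comment> \<open>For \<open>m = c w z d\<close>, the four-point axiom puts \<open>m\<close> in
      \<open>{x, c w d x, d}\<close> and, below, \<open>d\<close> in \<open>{x, c w d x, m}\<close>.
      As neither is \<open>x\<close>, they coincide.\<close>
    then have 1: "c w z d = c w d x \<or> c w z d = d"
      using four_point[of w z d x] d x T by (metis (full_types) empty_iff insert_iff sym12 sym23)
    have "d = c w d x \<or> d = c w z d"
      using four_point[of x z d w] d x T False
      by (metis (full_types) empty_iff insert_iff sym12 sym23)
    then show ?thesis using 1 by metis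
  qed (use x in simp)
  then show "d \<in> tree_interval T c w z" using d by (simp add: tree_interval_def)
qed

text \<open>If \<open>x\<close> lay on \<open>[w,z]\<close>, then
  \<open>d \<in> [x,z] \<subseteq> [w,z]\<close> would separate \<open>w\<close> from
  \<open>z\<close>.\<close>

lemma component_mono:
  assumes T: "x \<in> T" "z \<in> T" and d: "d \<in> tree_interval T c x z"
  shows "tree_component T c d z \<subseteq> tree_component T c x z"
proof
  fix w assume "w \<in> tree_component T c d z"
  then have w: "w \<in> T" "w \<noteq> d" "c d z w \<noteq> d" by (auto simp: tree_component_def)
  have dT: "d \<in> T" using d by (simp add: tree_interval_def)
  have "c x z w \<noteq> x"
  proof
    assume "c x z w = x"
    then have "c w z x = x" using T w by (metis sym12 sym23)
    then have "d \<in> tree_interval T c w z"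
      using interval_subset[of w z x] d T w by (auto simp: tree_interval_def)
    then have "c w z d = d" by (simp add: tree_interval_def)
    then show False using T w dT by (metis sym12 sym23)
  qed
  moreover have "w \<noteq> x"
    using d w T dT by (metis (mono_tags, lifting) mem_Collect_eq sym12 sym23 tree_interval_def)
  ultimately show "w \<in> tree_component T c x z"
    using w by (simp add: tree_component_def)
qed

text \<open>If \<open>c x y a\<close> or \<open>c x e a\<close> were \<open>p\<close>, then
  \<open>p\<close> would lie on \<open>[x,a]\<close>, against the choice of \<open>a\<close>; the
  four-point axiom leaves \<open>c y e a = p\<close>.\<close>

lemma branch_point_replace:
  assumes T: "x \<in> T" "y \<in> T" "e \<in> T" "a \<in> T" and p: "c x y e = p" and a: "c p x a \<noteq> p"
  shows "c a y e = p"
proof -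
  have pT: "p \<in> T" using p T closed by blast
  have "c x y a \<noteq> p" "c x e a \<noteq> p"
    using a T pT by (metis sym12 sym23 three_point)+
  then show ?thesis
    using four_point[of x y e a] T p by (auto simp: sym12 sym23 closed)
qed

lemma openin_component:
  assumes "x \<in> T" "y \<in> T" "x \<noteq> y"
  shows "openin (component_topology T c) (tree_component T c x y)"
  unfolding component_topology_def
  by (rule topology_generated_by_Basis) (use assms in blast)

lemma mem_component_self: "\<lbrakk>x \<in> T; y \<in> T; x \<noteq> y\<rbrakk> \<Longrightarrow> y \<in> tree_component T c x y"
  by (simp add: tree_component_def two_point)

lemma interval_commute: "\<lbrakk>x \<in> T; y \<in> T\<rbrakk> \<Longrightarrow> tree_interval T c x y = tree_interval T c y x"
  by (auto simp: tree_interval_def sym12)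

lemma countable_edges:
  assumes "countable D"
    and D: "\<And>x y. \<lbrakk>x \<in> T; y \<in> T; x \<noteq> y\<rbrakk> \<Longrightarrow> D \<inter> tree_interval_ropen T c x y \<noteq> {}"
  shows "countable (tree_edges T c)"
proof -
  \<comment> \<open>Here \<open>[x,y) = {x}\<close>; exchanging \<open>x\<close> and
    \<open>y\<close> handles the other endpoint.\<close>
  have "x \<in> D" if "x \<in> T" "y \<in> T" "x \<noteq> y" "tree_interval T c x y = {x, y}" for x y
    using D[of x y] that by (auto simp: tree_interval_ropen_def)
  then have "tree_edges T c \<subseteq> {F. finite F \<and> F \<subseteq> D}"
    unfolding tree_edges_def by (auto, metis insert_commute interval_commute)
  then show ?thesis
    using countable_Collect_finite_subset[OF assms(1)] countable_subset by blast
qed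

lemma second_countable_component_topology:
  assumes "countable D" "D \<subseteq> T"
    and D: "\<And>x y. \<lbrakk>x \<in> T; y \<in> T; x \<noteq> y\<rbrakk> \<Longrightarrow> D \<inter> tree_interval_ropen T c x y \<noteq> {}"
  shows "second_countable (component_topology T c)"
  unfolding component_topology_def
proof (rule second_countable_topology_generated_by)
  \<comment> \<open>The set \<open>T\<close> is included to refine the generator
    \<open>T\<close>.\<close>
  let ?C = "insert T ((\<lambda>(d, e). tree_component T c d e) ` ((D \<times> D) - Id))"
  show "countable ?C"
    using assms(1) by auto
  show "openin (topology_generated_by
        (insert T {tree_component T c x y |x y. x \<in> T \<and> y \<in> T \<and> x \<noteq> y})) C" if "C \<in> ?C" for C
    using that assms(2) by (intro topology_generated_by_Basis) fastforce
  show "\<exists>C\<in>?C. z \<in> C \<and> C \<subseteq> S"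
    if S: "S \<in> insert T {tree_component T c x y |x y. x \<in> T \<and> y \<in> T \<and> x \<noteq> y}" "z \<in> S" for S z
  proof (cases "S = T")
    case False
    then obtain x y where xy: "x \<in> T" "y \<in> T" "x \<noteq> y" "S = tree_component T c x y"
      using S(1) by blast
    then have z: "z \<in> T" "z \<noteq> x" "c x y z \<noteq> x"
      using that by (auto simp: tree_component_def)
    obtain d where d: "d \<in> D" "d \<in> tree_interval T c x z" "d \<noteq> z"
      using D[of x z] xy z by (auto simp: tree_interval_ropen_def)
    then have "d \<in> T" using assms(2) by blast
    \<comment> \<open>The interval is taken from \<open>z\<close> so that \<open>d\<close> is the
      excluded end: \<open>c d z e = e \<noteq> d\<close> then puts \<open>e\<close> in the
      component of \<open>T - {d}\<close> containing \<open>z\<close>.\<close>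
    obtain e where e: "e \<in> D" "e \<in> tree_interval T c z d" "e \<noteq> d"
      using D[of z d] \<open>d \<in> T\<close> d z by (auto simp: tree_interval_ropen_def)
    then have "e \<in> T" "c d z e = e"
      using assms(2) z \<open>d \<in> T\<close> by (auto simp: tree_interval_def sym12)
    then have "tree_component T c d e = tree_component T c d z"
      using component_cong[of d z e] z \<open>d \<in> T\<close> e by simp
    moreover have "tree_component T c d z \<subseteq> S"
      using component_mono[of x z d] component_cong[of x y z] xy z d by auto
    moreover have "z \<in> tree_component T c d z"
      using mem_component_self z \<open>d \<in> T\<close> d by blast
    moreover have "tree_component T c d e \<in> ?C"
      using d e by auto
    ultimately show ?thesis by metis
  qed (use that in blast)
qed

lemma interval_dense_branch_points:
  assumes "E \<subseteq> T" and dense: "component_topology T c closure_of E = T"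
    and xy: "x \<in> T" "y \<in> T" "x \<noteq> y"
  shows "((\<lambda>(a, b, e). c a b e) ` (E \<times> E \<times> E) \<union> \<Union>(tree_edges T c))
    \<inter> tree_interval_ropen T c x y \<noteq> {}"
proof (cases "tree_interval T c x y = {x, y}")
  case True
  then have "x \<in> \<Union>(tree_edges T c)" using xy by (auto simp: tree_edges_def)
  then show ?thesis using True xy by (auto simp: tree_interval_ropen_def)
next
  case False
  have meets: "\<exists>e. e \<in> E \<and> e \<in> U" if "openin (component_topology T c) U" "U \<noteq> {}" for U
    using that dense dense_intersects_open[of "component_topology T c" E] by auto
  have "{x, y} \<subseteq> tree_interval T c x y"
    using xy by (simp add: tree_interval_def two_point c_idem_left)
  then obtain z where z: "z \<in> T" "c x y z = z" "z \<noteq> x" "z \<noteq> y"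
    using False by (auto simp: tree_interval_def)
  then have z': "c y x z = z" using sym12 xy by simp
  \<comment> \<open>The point \<open>z\<close> shows that this open set is nonempty. A point
    \<open>e\<close> of \<open>E\<close> in it may lie off \<open>[x,y]\<close>, but its projection
    \<open>p = c x y e\<close> lies strictly inside.\<close>
  have "z \<in> tree_component T c x y \<inter> tree_component T c y x"
    using z z' by (simp add: tree_component_def)
  then obtain e where "e \<in> E" "e \<in> tree_component T c x y" "e \<in> tree_component T c y x"
    using meets[of "tree_component T c x y \<inter> tree_component T c y x"]
      openin_component[of x y] openin_component[of y x] xy by blast
  then have e: "e \<in> E" "e \<in> T" "c x y e \<noteq> x" "c y x e \<noteq> y"
    using assms(1) by (auto simp: tree_component_def)
  define p where "p = c x y e"
  have p: "p \<in> T" "p \<noteq> x" "p \<noteq> y" "c x y p = p"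
    unfolding p_def using e xy sym12 closed three_point by auto
  obtain a where "a \<in> E" "a \<in> tree_component T c p x"
    using meets[OF openin_component[of p x]] mem_component_self[of p x] p xy by blast
  then have a: "a \<in> E" "a \<in> T" "c p x a \<noteq> p"
    using assms(1) by (auto simp: tree_component_def)
  obtain b where "b \<in> E" "b \<in> tree_component T c p y"
    using meets[OF openin_component[of p y]] mem_component_self[of p y] p xy by blast
  then have b: "b \<in> E" "b \<in> T" "c p y b \<noteq> p"
    using assms(1) by (auto simp: tree_component_def)
  have "c a y e = p"
    using branch_point_replace[of x y e a p] xy e a p_def by blast
  \<comment> \<open>With \<open>y\<close> now in first place, the same lemma replaces it by
    \<open>b\<close>.\<close>
  then have "c y a e = p" using sym12 a xy e by simp
  then have "c b a e = p"
    using branch_point_replace[of y a e b p] xy e a b by blast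
  then have "p \<in> (\<lambda>(a, b, e). c a b e) ` (E \<times> E \<times> E)"
    using a b e by force
  moreover have "p \<in> tree_interval_ropen T c x y"
    using p by (simp add: tree_interval_ropen_def tree_interval_def)
  ultimately show ?thesis by blast
qed

lemma separable_imp_interval_dense:
  assumes "separable_space (component_topology T c)" "countable (tree_edges T c)"
  shows "\<exists>D. countable D \<and> D \<subseteq> T \<and>
    (\<forall>x\<in>T. \<forall>y\<in>T. x \<noteq> y \<longrightarrow> D \<inter> tree_interval_ropen T c x y \<noteq> {})"
proof -
  obtain E where E: "countable E" "E \<subseteq> T" "component_topology T c closure_of E = T"
    using assms(1) by (auto simp: separable_space_def)
  let ?D = "(\<lambda>(a, b, e). c a b e) ` (E \<times> E \<times> E) \<union> \<Union>(tree_edges T c)"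
  have "countable (\<Union>(tree_edges T c))"
    using countable_UN[OF assms(2), of "\<lambda>F. F"] by (force simp: tree_edges_def)
  then have "countable ?D"
    using E(1) by auto
  moreover have "?D \<subseteq> T"
    using E(2) by (auto simp: tree_edges_def intro!: closed)
  ultimately show ?thesis
    using interval_dense_branch_points[OF E(2,3)] by (intro exI[of _ ?D]) simp
qed

end

theorem proposition2p20:
  fixes T :: "'a set" and c :: "'a \<Rightarrow> 'a \<Rightarrow> 'a \<Rightarrow> 'a"
  assumes "algebraic_tree T c"
  shows "((\<exists>D. countable D \<and> D \<subseteq> T \<and>
             (\<forall>x\<in>T. \<forall>y\<in>T. x \<noteq> y \<longrightarrow> D \<inter> tree_interval_ropen T c x y \<noteq> {}))
          \<longleftrightarrow> (second_countable (component_topology T c) \<and> countable (tree_edges T c)))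
       \<and> ((second_countable (component_topology T c) \<and> countable (tree_edges T c))
          \<longleftrightarrow> (separable_space (component_topology T c) \<and> countable (tree_edges T c)))"
proof -
  interpret algebraic_tree T c by fact
  \<comment> \<open>The cycle 1, 2, 3, 1; the step from 2 to 3 is that second countable spaces are
    separable.\<close>
  show ?thesis
    using separable_imp_interval_dense second_countable_imp_separable_space
      second_countable_component_topology countable_edges
    by metis
qed

end
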